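(* The elasticity of the McNugget monoid $M = \langle 6, 9, 20\rangle$ is $\rho(M) = \frac{10}{3}$.
   Context: The McNugget monoid is $M = \langle 6, 9, 20 \rangle = \{6a + 9b + 20c : a, b, c \in \mathbb{N}_0\}$, a monoid under addition, where $\mathbb{N}_0$ is the set of nonnegative integers. For $x \in M$, the set of lengths of $x$ is $\mathcal{L}(x) = \{a + b + c : (a,b,c) \in \mathbb{N}_0^3,\ 6a + 9b + 20c = x\}$, a finite nonempty set; put $\ell(x) = \min \mathcal{L}(x)$ and $L(x) = \max \mathcal{L}(x)$. For nonzero $x \in M$, the elasticity of $x$ is $\rho(x) = L(x)/\ell(x)$, and the elasticity of $M$ is $\rho(M) = \sup\{\rho(x) : x \in M,\ x \ne 0\}$. *)

theory Defs
  imports Complex_Main "HOL-Library.Extended_Real"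
begin

definition mcnugget :: "nat set" where
  "mcnugget = {6 * a + 9 * b + 20 * c | a b c. True}"

definition length_set :: "nat \<Rightarrow> nat set" where
  "length_set x = {a + b + c | a b c. 6 * a + 9 * b + 20 * c = x}"

definition min_length :: "nat \<Rightarrow> nat" where
  "min_length x = Min (length_set x)"

definition max_length :: "nat \<Rightarrow> nat" where
  "max_length x = Max (length_set x)"

text \<open>\<open>Min\<close> and \<open>Max\<close> are meaningful here because of the following two facts.\<close>

lemma finite_length_set: "finite (length_set x)"
  by (rule finite_subset[of _ "{..x}"]) (auto simp: length_set_def)

lemma length_set_nonempty: "x \<in> mcnugget \<Longrightarrow> length_set x \<noteq> {}"
  by (auto simp: mcnugget_def length_set_def)

definition elasticity :: "nat \<Rightarrow> real" where
  "elasticity x = real (max_length x) / real (min_length x)"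

text \<open>The supremum is taken in the extended reals, so that a finite value of it includes the
  boundedness of the set of elasticities; \<open>Sup\<close> on \<open>real\<close> is unspecified for unbounded sets.\<close>

definition mcnugget_elasticity :: ereal where
  "mcnugget_elasticity = (SUP x \<in> mcnugget - {0}. ereal (elasticity x))"

end

theory Submission
  imports Defs
begin

text \<open>Every atom lies between 6 and 20, so a factorization of \<open>x\<close> of length \<open>n\<close> satisfies
  \<open>6 n \<le> x \<le> 20 n\<close>, which bounds every elasticity by \<open>20 / 6\<close>. The bound is attained at
  \<open>60 = 10 \<cdot> 6 = 3 \<cdot> 20\<close>.\<close>

lemma length_set_bounds:
  assumes "n \<in> length_set x"
  shows "6 * n \<le> x" and "x \<le> 20 * n"
  using assms by (auto simp: length_set_def)

lemma elasticity_le: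
  assumes "x \<in> mcnugget" and "x \<noteq> 0"
  shows "elasticity x \<le> 10 / 3"
proof -
  have "min_length x \<in> length_set x" "max_length x \<in> length_set x"
    using assms by (simp_all add: min_length_def max_length_def finite_length_set length_set_nonempty)
  then have "x \<le> 20 * min_length x" "6 * max_length x \<le> x"
    by (simp_all add: length_set_bounds)
  \<comment> \<open>Positivity follows from \<open>0 < x \<le> 20 * min_length x\<close>; it permits
    the division below.\<close>
  then have "6 * max_length x \<le> 20 * min_length x" and "min_length x > 0"
    using \<open>x \<noteq> 0\<close> by linarith+
  then show ?thesis
    by (simp add: elasticity_def divide_le_eq)
qed

lemma elasticity_60: "elasticity 60 = 10 / 3"
proof -
  have "10 \<in> length_set 60"
    unfolding length_set_def by (rule CollectI, rule exI[of _ 10], rule exI[of _ 0]) simp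
  moreover have "3 \<in> length_set 60"
    unfolding length_set_def by (rule CollectI, rule exI[of _ 0], rule exI[of _ 0]) simp
  \<comment> \<open>The bounds \<open>6 * n \<le> 60 \<le> 20 * n\<close> confine every length
    \<open>n\<close> of 60 to the range from 3 to 10, so the two lengths exhibited are
    extremal.\<close>
  ultimately have "max_length 60 = 10" "min_length 60 = 3"
    unfolding max_length_def min_length_def
    by (auto intro!: Max_eqI Min_eqI simp: finite_length_set dest: length_set_bounds)
  then show ?thesis
    by (simp add: elasticity_def)
qed

theorem corollary3p6:
  shows "mcnugget_elasticity = ereal (10 / 3)"
  unfolding mcnugget_elasticity_def
proof (rule antisym)
  show "(SUP x \<in> mcnugget - {0}. ereal (elasticity x)) \<le> ereal (10 / 3)"
    \<comment> \<open>The quotient \<open>10 / 3\<close> is kept intact so that the goal still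
      matches \<open>elasticity_le\<close>.\<close>
    using elasticity_le by (intro SUP_least) (simp del: le_divide_eq_numeral1)
  have "60 \<in> mcnugget"
    unfolding mcnugget_def by (rule CollectI, rule exI[of _ 10], rule exI[of _ 0]) simp
  then have "60 \<in> mcnugget - {0}"
    by simp
  then show "ereal (10 / 3) \<le> (SUP x \<in> mcnugget - {0}. ereal (elasticity x))"
    by (rule SUP_upper2) (simp add: elasticity_60)
qed

end
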